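(* Let $n$ be a positive integer. Let $\mathcal{B}_n$ denote the set of pairs $(T_1, T_2)$ of standard immaculate tableaux of the same shape $\alpha$, over all compositions $\alpha \vDash n$, and let $\mathcal{C}_n$ denote the set of immacutations of order $n$. Then the mapping $f\colon \mathcal{B}_n \to \mathcal{C}_n$ given by the row-truncation procedure defined in the context is a bijection from $\mathcal{B}_n$ to $\mathcal{C}_n$.
   Context: Compositions and tableaux. A composition $\alpha = (\alpha_1, \ldots, \alpha_{\ell(\alpha)})$ of a positive integer $n$, written $\alpha \vDash n$, is a finite tuple of positive integers with sum $n$. The diagram of $\alpha$ has $\ell(\alpha)$ left-justified rows, the $i$-th row having $\alpha_i$ cells. A standard immaculate tableau of shape $\alpha \vDash n$ is a filling of the cells of this diagram with the labels $1, 2, \ldots, n$, each used exactly once, such that each row is increasing when read from left to right and the first (leftmost) column is strictly increasing when read from the first row to the last row (no condition is imposed on the other columns). In particular, the label $1$ lies in the first cell of the first row. Immacutations. A weak partition is a finite tuple of weakly decreasing nonnegative integers; $\ell(\cdot)$ denotes the length of a tuple. Let $\lambda$ be a strictly decreasing weak partition that ends with $0$ (so its last entry is $0$ and it is nonempty) and whose largest part is at most $n-1$. An immacutation of order $n$ (and of class $\lambda$) is a tuple $t$ of length $2\ell(\lambda)$ such that $t_1$ and $t_2$ are subsets of $\{1, \ldots, n-1\}$ of size $n-1-\lambda_1$, and such that, for each $i \in \{2, \ldots, \ell(\lambda)\}$, $t_{2i-1}$ and $t_{2i}$ are subsets of $\{1, \ldots, \lambda_{i-1}-1\}$ of size $\lambda_{i-1}-1-\lambda_i$.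 The immacutations of order $n$ are all tuples so obtained, over all such $\lambda$. The map $f$. Let $(T_1^{(1)}, T_2^{(1)}) \in \mathcal{B}_n$ have common shape $\alpha$. For $2 \leq i \leq \ell(\alpha)$ and $r \in \{1,2\}$, let $T_r^{(i)}$ be obtained from $T_r^{(i-1)}$ by removing its first row and then relabelling the remaining labels with consecutive integers starting with $1$ in the order-preserving way (the smallest remaining label becomes $1$, the next smallest becomes $2$, and so on). For $1 \leq i \leq \ell(\alpha)$ and $r \in \{1,2\}$, let $S_r^{(i)}$ be the (possibly empty) set of labels to the right of the cell labelled $1$ in the first row of $T_r^{(i)}$, and let $\overline{S_r^{(i)}} = \{ s - 1 : s \in S_r^{(i)} \}$. Then $f(T_1^{(1)}, T_2^{(1)})$ is the tuple $$\big( \overline{S_1^{(1)}}, \overline{S_2^{(1)}}, \overline{S_1^{(2)}}, \overline{S_2^{(2)}}, \ldots, \overline{S_1^{(\ell(\alpha))}}, \overline{S_2^{(\ell(\alpha))}} \big).$$ *)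

theory Defs
  imports Main
begin

text \<open>
  Compositions and weak partitions are lists; a filling is the list of its rows, from the first to
  the last, each row being the list of its labels from left to right.  Lists are indexed from 0,
  so the entry with index \<open>i\<close> in the usual 1-based numbering is \<open>xs ! (i - 1)\<close>.
\<close>

definition composition :: "nat \<Rightarrow> nat list \<Rightarrow> bool" where
  "composition n \<alpha> \<longleftrightarrow> (\<forall>a\<in>set \<alpha>. 0 < a) \<and> sum_list \<alpha> = n"

definition shape :: "nat list list \<Rightarrow> nat list" where
  "shape T = map length T"

text \<open>Since the rows of a composition diagram are nonempty, \<open>map hd T\<close> is the first column.\<close>

definition standard_immaculate_tableau :: "nat list \<Rightarrow> nat list list \<Rightarrow> bool" where
  "standard_immaculate_tableau \<alpha> T \<longleftrightarrow>
     shape T = \<alpha> \<and>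
     distinct (concat T) \<and> set (concat T) = {1..sum_list \<alpha>} \<and>
     (\<forall>row\<in>set T. sorted_wrt (<) row) \<and>
     sorted_wrt (<) (map hd T)"

definition tableau_pairs :: "nat \<Rightarrow> (nat list list \<times> nat list list) set" where
  "tableau_pairs n = {(T\<^sub>1, T\<^sub>2). \<exists>\<alpha>. composition n \<alpha> \<and>
     standard_immaculate_tableau \<alpha> T\<^sub>1 \<and> standard_immaculate_tableau \<alpha> T\<^sub>2}"

definition immacutation_class :: "nat \<Rightarrow> nat list \<Rightarrow> bool" where
  "immacutation_class n lam \<longleftrightarrow>
     lam \<noteq> [] \<and> sorted_wrt (>) lam \<and> last lam = 0 \<and> (\<forall>x\<in>set lam. x \<le> n - 1)"

text \<open>
  For \<open>0 < n\<close> and \<open>immacutation_class n lam\<close> none of the subtractions below truncates.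
\<close>

definition immacutation_of_class :: "nat \<Rightarrow> nat list \<Rightarrow> nat set list \<Rightarrow> bool" where
  "immacutation_of_class n lam t \<longleftrightarrow>
     length t = 2 * length lam \<and>
     (\<forall>A\<in>{t ! 0, t ! 1}. A \<subseteq> {1..n - 1} \<and> card A = n - 1 - lam ! 0) \<and>
     (\<forall>i\<in>{2..length lam}. \<forall>A\<in>{t ! (2 * i - 2), t ! (2 * i - 1)}.
        A \<subseteq> {1..lam ! (i - 2) - 1} \<and> card A = lam ! (i - 2) - 1 - lam ! (i - 1))"

definition immacutations :: "nat \<Rightarrow> nat set list set" where
  "immacutations n = {t. \<exists>lam. immacutation_class n lam \<and> immacutation_of_class n lam t}"

text \<open>Each label is replaced by its rank among the labels of the filling.\<close>

definition relabel :: "nat list list \<Rightarrow> nat list list" where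
  "relabel T = map (map (\<lambda>x. card {y \<in> set (concat T). y \<le> x})) T"

definition truncate :: "nat list list \<Rightarrow> nat list list" where
  "truncate T = relabel (tl T)"

definition right_of_one :: "nat list list \<Rightarrow> nat set" where
  "right_of_one T = {hd T ! k | j k. j < k \<and> k < length (hd T) \<and> hd T ! j = 1}"

definition shifted_right_of_one :: "nat list list \<Rightarrow> nat set" where
  "shifted_right_of_one T = (\<lambda>s. s - 1) ` right_of_one T"

text \<open>The iterate \<open>(truncate ^^ i) T\<close> is the tableau left after truncating \<open>i\<close> rows.\<close>

definition truncation_map :: "nat list list \<times> nat list list \<Rightarrow> nat set list" where
  "truncation_map = (\<lambda>(T\<^sub>1, T\<^sub>2).
     concat (map (\<lambda>i. [shifted_right_of_one ((truncate ^^ i) T\<^sub>1),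
                       shifted_right_of_one ((truncate ^^ i) T\<^sub>2)])
       [0..<length (shape T\<^sub>1)]))"

end

theory Submission
  imports Defs
begin

text \<open>
  A standard immaculate tableau with \<open>m + 1\<close> cells is the same thing as a subset \<open>A\<close> of
  \<open>{1..m}\<close> together with a standard immaculate tableau with \<open>m - card A\<close> cells.  Indeed, the label
  1 heads the first row, so the first row is known once the set \<open>A + 1\<close> of its other labels is
  known.  As the head of that row lies below all other labels, the first column puts no condition
  linking the first row to the later ones: every choice of \<open>A\<close> is allowed, and the later rows form
  an arbitrary increasing filling with the labels left over.  Relabelling by rank identifies such
  fillings with standard tableaux, because the rank function of a finite set is an order
  isomorphism onto an initial segment (\<open>bij_betw_rank\<close>).  The result is
  \<open>bij_betw_split_first_row\<close>.

  Immacutations obey the same recursion, for pairs.  The first two sets are subsets of \<open>{1..m}\<close>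
  with a common size \<open>m - l\<close>, where \<open>l\<close> is the first part of the class, and the remaining sets form
  an immacutation of order \<open>l\<close>, or are absent if \<open>l = 0\<close> (\<open>immacutation_tails_Suc\<close>).  On the
  tableau side the two sets have a common size exactly because the first rows have a common
  length, and the truncated tableaux again have a common shape.  Strong induction on the number of
  cells compares the two recursions.
\<close>

section \<open>Ranks in a finite set\<close>

definition rank :: "nat set \<Rightarrow> nat \<Rightarrow> nat" where
  "rank V x = card {y \<in> V. y \<le> x}"

lemma strict_mono_on_rank:
  assumes "finite V"
  shows "strict_mono_on V (rank V)"
proof (rule strict_mono_onI)
  fix x y assume "x \<in> V" "y \<in> V" "x < y"
  then have "{z \<in> V. z \<le> x} \<subset> {z \<in> V. z \<le> y}" by force
  with assms show "rank V x < rank V y"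
    unfolding rank_def by (intro psubset_card_mono) auto
qed

lemma bij_betw_rank:
  assumes "finite V"
  shows "bij_betw (rank V) V {1..card V}"
proof -
  have inj: "inj_on (rank V) V"
    using strict_mono_on_rank[OF assms] by (rule strict_mono_on_imp_inj_on)
  have "rank V ` V \<subseteq> {1..card V}"
  proof
    fix k assume "k \<in> rank V ` V"
    then obtain x where x: "x \<in> V" "k = card {y \<in> V. y \<le> x}" by (auto simp: rank_def)
    have "card {x} \<le> card {y \<in> V. y \<le> x}" using x assms by (intro card_mono) auto
    moreover have "card {y \<in> V. y \<le> x} \<le> card V" using assms by (intro card_mono) auto
    ultimately show "k \<in> {1..card V}" using x by simp
  qed
  then have "rank V ` V = {1..card V}"
    by (intro card_subset_eq) (simp_all add: card_image[OF inj])
  with inj show ?thesis by (simp add: bij_betw_def)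
qed

definition unrank :: "nat set \<Rightarrow> nat \<Rightarrow> nat" where
  "unrank V = inv_into V (rank V)"

lemma unrank_rank: "finite V \<Longrightarrow> x \<in> V \<Longrightarrow> unrank V (rank V x) = x"
  unfolding unrank_def by (metis bij_betw_inv_into_left bij_betw_rank)

lemma rank_unrank: "finite V \<Longrightarrow> k \<in> {1..card V} \<Longrightarrow> rank V (unrank V k) = k"
  unfolding unrank_def by (metis bij_betw_inv_into_right bij_betw_rank)

lemma unrank_image: "finite V \<Longrightarrow> unrank V ` {1..card V} = V"
  unfolding unrank_def by (metis bij_betw_def bij_betw_inv_into bij_betw_rank)

lemma strict_mono_on_unrank:
  assumes "finite V"
  shows "strict_mono_on {1..card V} (unrank V)"
proof (rule strict_mono_onI)
  fix k l assume kl: "k \<in> {1..card V}" "l \<in> {1..card V}" "k < l"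
  have mem: "unrank V k \<in> V" "unrank V l \<in> V" using unrank_image[OF assms] kl by auto
  show "unrank V k < unrank V l"
  proof (rule ccontr)
    assume "\<not> unrank V k < unrank V l"
    then have "rank V (unrank V l) \<le> rank V (unrank V k)"
      using strict_mono_on_leD[OF strict_mono_on_rank[OF assms]] mem by simp
    with kl show False by (simp add: rank_unrank[OF assms])
  qed
qed


section \<open>Increasing fillings\<close>

text \<open>
  Removing the first row of a tableau leaves labels that are not consecutive, so the conditions on
  a tableau are stated here for an arbitrary set of labels.
\<close>

definition increasing_filling :: "nat set \<Rightarrow> nat list list \<Rightarrow> bool" where
  "increasing_filling X T \<longleftrightarrow>
     [] \<notin> set T \<and> distinct (concat T) \<and> set (concat T) = X \<and>
     (\<forall>row\<in>set T. sorted_wrt (<) row) \<and> sorted_wrt (<) (map hd T)"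

lemma increasing_filling_map:
  assumes T: "increasing_filling X T" and g: "strict_mono_on X g"
  shows "increasing_filling (g ` X) (map (map g) T)"
proof -
  have X: "set (concat T) = X" and ne: "[] \<notin> set T"
    using T by (auto simp: increasing_filling_def)
  have inj: "inj_on g X" using g by (rule strict_mono_on_imp_inj_on)
  have rowX: "row \<in> set T \<Longrightarrow> set row \<subseteq> X" for row using X by auto
  have sorted: "sorted_wrt (<) (map g xs)" if "sorted_wrt (<) xs" "set xs \<subseteq> X" for xs
    unfolding sorted_wrt_map
    by (rule sorted_wrt_mono_rel[OF _ that(1)])
       (use that(2) in \<open>auto intro: strict_mono_onD[OF g]\<close>)
  have hds: "map hd (map (map g) T) = map g (map hd T)"
    using ne by (auto; metis list.map_sel(1))
  have "set (map hd T) \<subseteq> X" using ne rowX by (auto; metis hd_in_set subsetD)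
  then have "sorted_wrt (<) (map hd (map (map g) T))"
    unfolding hds using T by (intro sorted) (auto simp: increasing_filling_def)
  moreover have "\<forall>row\<in>set (map (map g) T). sorted_wrt (<) row"
    using T rowX sorted by (auto simp: increasing_filling_def)
  moreover have "distinct (concat (map (map g) T))" "set (concat (map (map g) T)) = g ` X"
    using T inj X by (simp_all add: increasing_filling_def distinct_map flip: map_concat)
  ultimately show ?thesis
    using ne by (auto simp: increasing_filling_def)
qed

text \<open>
  Row monotonicity puts the smallest label of every row into the first column, so once the first
  label is a lower bound for \<open>X\<close>, the first row and the later rows no longer constrain each other
  except by sharing out the labels.
\<close>

lemma increasing_filling_Cons_iff:
  "increasing_filling X (r # U) \<longleftrightarrow>
     r \<noteq> [] \<and> sorted_wrt (<) r \<and> set r \<subseteq> X \<and> (\<forall>x\<in>X. hd r \<le> x) \<and>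
     increasing_filling (X - set r) U"
  (is "?L \<longleftrightarrow> ?R")
proof
  assume L: ?L
  then have r: "r \<noteq> []" "sorted_wrt (<) r" and X: "X = set r \<union> set (concat U)"
    and disj: "set r \<inter> set (concat U) = {}" and rows: "\<forall>row\<in>set U. sorted_wrt (<) row"
    and ne: "[] \<notin> set U" and hds: "\<forall>row\<in>set U. hd r < hd row"
    by (auto simp: increasing_filling_def)
  have hd_le: "hd row \<le> x" if "sorted_wrt (<) row" "x \<in> set row" for row :: "nat list" and x
    using that by (cases row) auto
  have "hd r \<le> x" if "x \<in> X" for x
  proof (cases "x \<in> set r")
    case True
    with r show ?thesis by (intro hd_le) auto
  next
    case False
    then have "x \<in> set (concat U)" using that X by blast
    then obtain row where row: "row \<in> set U" "x \<in> set row" by auto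
    then have "hd r < hd row" "hd row \<le> x" using hds rows hd_le by blast+
    then show ?thesis by simp
  qed
  moreover have "X - set r = set (concat U)" using X disj by blast
  ultimately show ?R using L X r by (auto simp: increasing_filling_def)
next
  assume R: ?R
  then have U: "increasing_filling (X - set r) U" by blast
  then have cU: "set (concat U) = X - set r" and ne: "[] \<notin> set U"
    by (auto simp: increasing_filling_def)
  have "hd r < hd row" if "row \<in> set U" for row
  proof -
    have "row \<noteq> []" using that ne by auto
    then have "hd row \<in> set (concat U)" using that hd_in_set by fastforce
    then have "hd row \<in> X" "hd row \<notin> set r" using cU by auto
    moreover have "hd r \<in> set r" using R by simp
    ultimately show ?thesis using R by (metis order_le_imp_less_or_eq)
  qed
  moreover have "distinct r" using R strict_sorted_iff by blast
  ultimately show ?L using R U cU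
    unfolding increasing_filling_def by auto
qed

lemma relabel_eq_map_rank: "relabel U = map (map (rank (set (concat U)))) U"
  by (simp add: relabel_def rank_def[abs_def])

lemma relabel_unrank:
  assumes "finite V" and "set (concat T) = {1..card V}"
  shows "relabel (map (map (unrank V)) T) = T"
proof -
  have "set (concat (map (map (unrank V)) T)) = V"
    using unrank_image[OF assms(1)] assms(2) by (simp flip: map_concat image_UN)
  then have "relabel (map (map (unrank V)) T) = map (map (rank V \<circ> unrank V)) T"
    by (simp add: relabel_eq_map_rank)
  also have "\<dots> = T"
  proof (intro map_idI)
    fix row k assume "row \<in> set T" "k \<in> set row"
    then have "k \<in> {1..card V}" unfolding assms(2)[symmetric] by auto
    then show "(rank V \<circ> unrank V) k = k" by (simp add: rank_unrank[OF assms(1)])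
  qed
  finally show ?thesis .
qed

lemma unrank_relabel:
  assumes "set (concat U) = V"
  shows "map (map (unrank V)) (relabel U) = U"
proof -
  have fin: "finite V" using assms by (metis List.finite_set)
  have "map (map (unrank V)) (relabel U) = map (map (unrank V \<circ> rank V)) U"
    using assms by (simp add: relabel_eq_map_rank)
  also have "\<dots> = U"
    by (intro map_idI) (use unrank_rank[OF fin] assms in auto)
  finally show ?thesis .
qed


section \<open>Splitting off the first row of a tableau\<close>

definition tableaux :: "nat \<Rightarrow> nat list list set" where
  "tableaux n = {T. increasing_filling {1..n} T}"

lemma tableaux_0: "tableaux 0 = {[]}"
proof -
  have "T = []" if "increasing_filling {} T" for T
    using that by (cases T) (auto simp: increasing_filling_def)
  moreover have "increasing_filling {} []" by (simp add: increasing_filling_def)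
  ultimately show ?thesis by (auto simp: tableaux_def)
qed

lemma tableau_pairs_eq:
  "tableau_pairs n = {(T\<^sub>1, T\<^sub>2). T\<^sub>1 \<in> tableaux n \<and> T\<^sub>2 \<in> tableaux n \<and> shape T\<^sub>1 = shape T\<^sub>2}"
proof -
  have size: "sum_list (shape T) = n" if "distinct (concat T)" "set (concat T) = {1..n}" for T
    using distinct_card[OF that(1)] that(2) by (simp add: shape_def length_concat)
  have pos: "(\<forall>a\<in>set (shape T). 0 < a) \<longleftrightarrow> [] \<notin> set T" for T
    by (force simp: shape_def)
  have "composition n (shape T) \<and> standard_immaculate_tableau (shape T) T \<longleftrightarrow> T \<in> tableaux n" for T
    unfolding composition_def standard_immaculate_tableau_def tableaux_def
      increasing_filling_def pos
    using size[of T] by auto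
  moreover have "standard_immaculate_tableau \<alpha> T \<Longrightarrow> \<alpha> = shape T" for \<alpha> T
    by (simp add: standard_immaculate_tableau_def)
  ultimately show ?thesis
    unfolding tableau_pairs_def by (auto; metis)
qed

lemma right_of_one_Cons:
  assumes "distinct (1 # s)"
  shows "right_of_one ((1 # s) # U) = set s"
proof -
  have "(1 # s) ! j = 1 \<longleftrightarrow> j = 0" if "j < length (1 # s)" for j
    using nth_eq_iff_index_eq[OF assms that, of 0] by simp
  then have "right_of_one ((1 # s) # U) = {(1 # s) ! k | k. 0 < k \<and> k < length (1 # s)}"
    unfolding right_of_one_def by (auto; metis less_trans length_Cons)
  also have "\<dots> = set s"
    unfolding set_conv_nth by (auto simp: gr0_conv_Suc; metis Suc_less_eq nth_Cons_Suc)
  finally show ?thesis .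
qed

text \<open>The first row that the split-off set \<open>A\<close> comes from: the shift by 1 is undone.\<close>

definition row_of :: "nat set \<Rightarrow> nat list" where
  "row_of A = sorted_list_of_set (insert 1 (Suc ` A))"

lemma set_row_of: "finite A \<Longrightarrow> set (row_of A) = insert 1 (Suc ` A)"
  unfolding row_of_def by (rule set_sorted_list_of_set) simp

lemma row_of_Cons:
  assumes "finite A" "0 \<notin> A"
  shows "row_of A = 1 # sorted_list_of_set (Suc ` A)"
proof -
  have "1 \<notin> Suc ` A" using assms by auto
  moreover have "Min (insert 1 (Suc ` A)) = 1" using assms by (intro Min_eqI) auto
  ultimately show ?thesis
    using assms by (simp add: row_of_def sorted_list_of_set_nonempty)
qed

text \<open>
  The inverse of splitting off the first row: the relabelling by rank is undone with the labels
  that the new first row leaves over.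
\<close>

definition prepend_row :: "nat \<Rightarrow> nat set \<Rightarrow> nat list list \<Rightarrow> nat list list" where
  "prepend_row m A T = row_of A # map (map (unrank ({1..Suc m} - set (row_of A)))) T"

lemma card_remaining_labels:
  assumes "A \<subseteq> {1..m}"
  shows "card ({1..Suc m} - set (row_of A)) = m - card A"
proof -
  have fin: "finite A" using assms finite_subset by blast
  have "1 \<notin> Suc ` A" using assms by auto
  then have "card (insert 1 (Suc ` A)) = Suc (card A)"
    using fin by (simp add: card_image)
  moreover have "insert 1 (Suc ` A) \<subseteq> {1..Suc m}" using assms by auto
  ultimately show ?thesis using fin by (simp add: set_row_of card_Diff_subset)
qed

lemma tableau_Suc_first_row:
  assumes "T \<in> tableaux (Suc m)"
  obtains s U where "T = (1 # s) # U" "sorted_wrt (<) (1 # s)" "set s \<subseteq> {2..Suc m}"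
    "increasing_filling ({1..Suc m} - set (1 # s)) U"
proof -
  have fill: "increasing_filling {1..Suc m} T" using assms by (simp add: tableaux_def)
  then have "T \<noteq> []" by (auto simp: increasing_filling_def)
  then obtain r U where T: "T = r # U" by (cases T) auto
  have r: "r \<noteq> []" "sorted_wrt (<) r" "set r \<subseteq> {1..Suc m}" "\<forall>x\<in>{1..Suc m}. hd r \<le> x"
    "increasing_filling ({1..Suc m} - set r) U"
    using fill unfolding T increasing_filling_Cons_iff by blast+
  obtain h s where hs: "r = h # s" using r(1) by (cases r) auto
  have "h = 1" using r(3,4) hs by (auto intro: antisym)
  moreover have "set s \<subseteq> {2..Suc m}" using r(2,3) hs \<open>h = 1\<close> by fastforce
  ultimately show ?thesis using that T hs r by blast
qed

lemma shifted_right_of_one_Cons: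
  assumes "sorted_wrt (<) (1 # s)"
  shows "shifted_right_of_one ((1 # s) # U) = (\<lambda>x. x - 1) ` set s"
  using assms right_of_one_Cons[of s U] strict_sorted_iff[of "1 # s"]
  by (simp add: shifted_right_of_one_def)

lemma row_of_shifted:
  assumes "sorted_wrt (<) (1 # s)"
  shows "row_of ((\<lambda>x. x - 1) ` set s) = 1 # s"
proof -
  have "Suc ` (\<lambda>x. x - 1) ` set s = set s" using assms by (force simp: image_image)
  then have "row_of ((\<lambda>x. x - 1) ` set s) = sorted_list_of_set (set (1 # s))"
    by (simp add: row_of_def)
  also have "\<dots> = 1 # s"
    using assms strict_sorted_iff[of "1 # s"]
    by (intro sorted_list_of_set.idem_if_sorted_distinct) auto
  finally show ?thesis .
qed

lemma split_first_row_in: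
  assumes "T \<in> tableaux (Suc m)"
  shows "shifted_right_of_one T \<subseteq> {1..m}"
    and "truncate T \<in> tableaux (m - card (shifted_right_of_one T))"
    and "prepend_row m (shifted_right_of_one T) (truncate T) = T"
    and "shape T = Suc (card (shifted_right_of_one T)) # shape (truncate T)"
proof -
  obtain s U where T: "T = (1 # s) # U" and s: "sorted_wrt (<) (1 # s)" "set s \<subseteq> {2..Suc m}"
    and U: "increasing_filling ({1..Suc m} - set (1 # s)) U"
    using tableau_Suc_first_row[OF assms] .
  define A where "A = shifted_right_of_one T"
  define V where "V = {1..Suc m} - set (1 # s)"
  have A: "A = (\<lambda>x. x - 1) ` set s" unfolding A_def T by (rule shifted_right_of_one_Cons[OF s(1)])
  have row: "row_of A = 1 # s" unfolding A by (rule row_of_shifted[OF s(1)])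
  show sub: "shifted_right_of_one T \<subseteq> {1..m}"
    using s(2) by (force simp: A[unfolded A_def])
  have cU: "set (concat U) = V" using U by (simp add: increasing_filling_def V_def)
  have fin: "finite V" by (simp add: V_def)
  have cardV: "card V = m - card A"
    using card_remaining_labels[OF sub] by (simp add: V_def row A_def[symmetric])
  have trunc: "truncate T = relabel U" by (simp add: T truncate_def)
  have "increasing_filling (rank V ` V) (map (map (rank V)) U)"
    using U strict_mono_on_rank[OF fin] by (intro increasing_filling_map) (simp_all add: V_def)
  then show "truncate T \<in> tableaux (m - card (shifted_right_of_one T))"
    using bij_betw_imp_surj_on[OF bij_betw_rank[OF fin]] cU cardV
    by (simp add: tableaux_def trunc relabel_eq_map_rank A_def)
  show "prepend_row m (shifted_right_of_one T) (truncate T) = T"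
    using unrank_relabel[OF cU] row
    by (simp add: prepend_row_def trunc T[symmetric] A_def[symmetric] V_def) (simp add: T)
  have "inj_on (\<lambda>x. x - 1) (set s)" using s(2) by (intro inj_onI) force
  moreover have "distinct s" using s(1) strict_sorted_iff[of "1 # s"] by simp
  ultimately have "card A = length s" unfolding A by (simp add: card_image distinct_card)
  then show "shape T = Suc (card (shifted_right_of_one T)) # shape (truncate T)"
    by (simp add: trunc A_def[symmetric]) (simp add: T shape_def relabel_def)
qed

lemma prepend_row_in:
  assumes A: "A \<subseteq> {1..m}" and T: "T \<in> tableaux (m - card A)"
  shows "prepend_row m A T \<in> tableaux (Suc m)"
    and "shifted_right_of_one (prepend_row m A T) = A"
    and "truncate (prepend_row m A T) = T"
proof -
  have fin: "finite A" "0 \<notin> A" using A finite_subset by auto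
  define s where "s = sorted_list_of_set (Suc ` A)"
  have row: "row_of A = 1 # s" using row_of_Cons[OF fin] by (simp add: s_def)
  have sorted: "sorted_wrt (<) (1 # s)"
    unfolding row[symmetric] row_of_def by simp
  have set_s: "set s = Suc ` A" using fin by (simp add: s_def)
  define V where "V = {1..Suc m} - set (row_of A)"
  have finV: "finite V" by (simp add: V_def)
  have cardV: "card V = m - card A" using card_remaining_labels[OF A] by (simp add: V_def)
  have fill: "increasing_filling {1..card V} T" using T by (simp add: tableaux_def cardV)
  have prep: "prepend_row m A T = (1 # s) # map (map (unrank V)) T"
    by (simp add: prepend_row_def V_def row)
  have "increasing_filling V (map (map (unrank V)) T)"
    using increasing_filling_map[OF fill strict_mono_on_unrank[OF finV]]
    by (simp only: unrank_image[OF finV])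
  moreover have "set (1 # s) \<subseteq> {1..Suc m}" using A set_s by auto
  ultimately show "prepend_row m A T \<in> tableaux (Suc m)"
    using sorted unfolding tableaux_def mem_Collect_eq prep increasing_filling_Cons_iff
    by (simp add: V_def row)
  show "shifted_right_of_one (prepend_row m A T) = A"
    unfolding prep shifted_right_of_one_Cons[OF sorted] by (simp add: set_s image_image)
  show "truncate (prepend_row m A T) = T"
    using relabel_unrank[OF finV] fill by (simp add: prep truncate_def increasing_filling_def)
qed

lemma bij_betw_split_first_row:
  "bij_betw (\<lambda>T. (shifted_right_of_one T, truncate T)) (tableaux (Suc m))
     (SIGMA A:Pow {1..m}. tableaux (m - card A))"
  (is "bij_betw ?split _ ?codes")
proof (rule bij_betw_byWitness[where f' = "\<lambda>(A, T). prepend_row m A T"])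
  show "\<forall>T\<in>tableaux (Suc m). (case ?split T of (A, T) \<Rightarrow> prepend_row m A T) = T"
    using split_first_row_in(3) by simp
  show "\<forall>p\<in>?codes. ?split (case p of (A, T) \<Rightarrow> prepend_row m A T) = p"
    using prepend_row_in(2,3) by auto
  show "?split ` tableaux (Suc m) \<subseteq> ?codes"
    using split_first_row_in(1,2) by blast
  show "(\<lambda>(A, T). prepend_row m A T) ` ?codes \<subseteq> tableaux (Suc m)"
    using prepend_row_in(1) by auto
qed


section \<open>The recursion for immacutations\<close>

text \<open>
  What may follow the first two sets of an immacutation: an immacutation of smaller order, or, once
  the class has reached its final part 0, nothing.
\<close>

definition immacutation_tails :: "nat \<Rightarrow> nat set list set" where
  "immacutation_tails n = (if n = 0 then {[]} else immacutations n)"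

lemma immacutation_class_Cons:
  "immacutation_class n (l # lam) \<longleftrightarrow>
     l \<le> n - 1 \<and> (if lam = [] then l = 0 else 0 < l \<and> immacutation_class l lam)"
proof (cases "lam = []")
  case False
  then have "last lam \<in> set lam" by simp
  then have "(\<forall>x\<in>set lam. x < l) \<longleftrightarrow> 0 < l \<and> (\<forall>x\<in>set lam. x \<le> l - 1)" by fastforce
  moreover have "\<forall>x\<in>set lam. x \<le> n - 1" if "l \<le> n - 1" "\<forall>x\<in>set lam. x < l"
    using that by fastforce
  ultimately show ?thesis
    using False unfolding immacutation_class_def by auto
qed (auto simp: immacutation_class_def)

lemma immacutation_of_class_Cons:
  "immacutation_of_class n (l # lam) (A # B # t) \<longleftrightarrow>
     A \<subseteq> {1..n - 1} \<and> B \<subseteq> {1..n - 1} \<and> card A = n - 1 - l \<and> card B = n - 1 - l \<and>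
     (if lam = [] then t = [] else immacutation_of_class l lam t)"
proof (cases "lam = []")
  case False
  define P :: "nat set list \<Rightarrow> nat list \<Rightarrow> nat \<Rightarrow> bool" where
    "P xs ls i \<longleftrightarrow> (\<forall>X\<in>{xs ! (2 * i - 2), xs ! (2 * i - 1)}.
       X \<subseteq> {1..ls ! (i - 2) - 1} \<and> card X = ls ! (i - 2) - 1 - ls ! (i - 1))" for xs ls i
  have unfold: "immacutation_of_class k ls xs \<longleftrightarrow>
     length xs = 2 * length ls \<and>
     (\<forall>X\<in>{xs ! 0, xs ! 1}. X \<subseteq> {1..k - 1} \<and> card X = k - 1 - ls ! 0) \<and>
     (\<forall>i\<in>{2..length ls}. P xs ls i)" for k ls xs
    by (simp only: immacutation_of_class_def P_def)
  \<comment> \<open>The condition with index 2 for the whole tuple is the one on the first two sets of \<open>t\<close>;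
    the conditions with larger indices move down by one.\<close>
  have "P (A # B # t) (l # lam) 2 \<longleftrightarrow>
      (\<forall>X\<in>{t ! 0, t ! 1}. X \<subseteq> {1..l - 1} \<and> card X = l - 1 - lam ! 0)"
    by (simp add: P_def numeral_eq_Suc)
  moreover have "P (A # B # t) (l # lam) (Suc i) \<longleftrightarrow> P t lam i" if "i \<in> {2..length lam}" for i
  proof -
    from that obtain j where "i = Suc (Suc j)" by (auto simp: le_iff_add)
    then show ?thesis by (simp add: P_def)
  qed
  moreover have "{2..Suc (length lam)} = insert 2 (Suc ` {2..length lam})"
  proof -
    have "{2..Suc (length lam)} = insert 2 {Suc 2..Suc (length lam)}"
      using False by (cases lam) auto
    then show ?thesis by (simp only: image_Suc_atLeastAtMost)
  qed
  ultimately have "(\<forall>i\<in>{2..length (l # lam)}. P (A # B # t) (l # lam) i) \<longleftrightarrow>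
      (\<forall>X\<in>{t ! 0, t ! 1}. X \<subseteq> {1..l - 1} \<and> card X = l - 1 - lam ! 0) \<and>
      (\<forall>i\<in>{2..length lam}. P t lam i)"
    by (simp only: list.size(4) add_Suc_right add_0_right One_nat_def ball_simps cong: ball_cong)
  then show ?thesis
    unfolding unfold using False by auto
qed (auto simp: immacutation_of_class_def)

lemma immacutation_tails_Suc:
  "immacutation_tails (Suc m) =
     {A # B # t | A B t. A \<subseteq> {1..m} \<and> B \<subseteq> {1..m} \<and> card A = card B \<and>
        t \<in> immacutation_tails (m - card A)}"
  (is "_ = ?R")
proof (intro equalityI subsetI)
  fix u assume "u \<in> immacutation_tails (Suc m)"
  then obtain lam where lam: "immacutation_class (Suc m) lam" "immacutation_of_class (Suc m) lam u"
    by (auto simp: immacutation_tails_def immacutations_def)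
  then obtain l lam' where l: "lam = l # lam'"
    by (cases lam) (auto simp: immacutation_class_def)
  have "length u = 2 * length lam" using lam(2) by (simp add: immacutation_of_class_def)
  then obtain A B t where u: "u = A # B # t"
    unfolding l by (cases u; cases "tl u") auto
  have *: "A \<subseteq> {1..m}" "B \<subseteq> {1..m}" "card A = m - l" "card B = m - l" "l \<le> m"
    using lam unfolding l u immacutation_class_Cons immacutation_of_class_Cons by auto
  then have "m - card A = l" by simp
  then have "t \<in> immacutation_tails (m - card A)"
    using lam unfolding l u immacutation_class_Cons immacutation_of_class_Cons
    by (auto simp: immacutation_tails_def immacutations_def split: if_splits)
  with * show "u \<in> ?R" unfolding u by auto
next
  fix u assume "u \<in> ?R"
  then obtain A B t where u: "u = A # B # t" and AB: "A \<subseteq> {1..m}" "B \<subseteq> {1..m}" "card A = card B"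
    and t: "t \<in> immacutation_tails (m - card A)" by blast
  define l where "l = m - card A"
  have "card A \<le> m" using card_mono[OF _ AB(1)] by simp
  then have l: "l \<le> m" "card A = m - l" by (simp_all add: l_def)
  have "\<exists>lam. immacutation_class (Suc m) (l # lam) \<and> immacutation_of_class (Suc m) (l # lam) u"
  proof (cases "l = 0")
    case True
    then have "immacutation_class (Suc m) [l]" "immacutation_of_class (Suc m) [l] u"
      using AB l t unfolding u immacutation_class_Cons immacutation_of_class_Cons
      by (simp_all add: immacutation_tails_def)
    then show ?thesis by blast
  next
    case False
    then obtain lam where lam: "immacutation_class l lam" "immacutation_of_class l lam t"
      using t by (auto simp: immacutation_tails_def immacutations_def l_def[symmetric])
    moreover have "lam \<noteq> []" using lam(1) by (simp add: immacutation_class_def)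
    ultimately have "immacutation_class (Suc m) (l # lam)"
      "immacutation_of_class (Suc m) (l # lam) u"
      using AB l False unfolding u immacutation_class_Cons immacutation_of_class_Cons by simp_all
    then show ?thesis by blast
  qed
  then show "u \<in> immacutation_tails (Suc m)"
    by (auto simp: immacutation_tails_def immacutations_def)
qed


section \<open>The bijection\<close>

lemma truncation_map_Suc:
  assumes "T\<^sub>1 \<in> tableaux (Suc m)"
  shows "truncation_map (T\<^sub>1, T\<^sub>2) =
    shifted_right_of_one T\<^sub>1 # shifted_right_of_one T\<^sub>2 # truncation_map (truncate T\<^sub>1, truncate T\<^sub>2)"
proof -
  have "length (shape T\<^sub>1) = Suc (length (shape (truncate T\<^sub>1)))"
    using split_first_row_in(4)[OF assms] by (metis length_Cons)
  then have "[0..<length (shape T\<^sub>1)] = 0 # map Suc [0..<length (shape (truncate T\<^sub>1))]"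
    by (simp add: map_Suc_upt upt_conv_Cons del: upt_Suc)
  then show ?thesis
    by (simp add: truncation_map_def comp_def funpow_swap1 del: upt_Suc)
qed

text \<open>
  In the induction the number of cells drops to 0 when the last row is removed, so the empty
  tableau and the empty tail are included here.
\<close>

lemma bij_betw_truncation_map_tails:
  "bij_betw truncation_map (tableau_pairs n) (immacutation_tails n)"
proof (induction n rule: less_induct)
  case (less n)
  show ?case
  proof (cases n)
    case 0
    have "truncation_map ([], []) = []" by (simp add: truncation_map_def shape_def)
    moreover have "tableau_pairs n = {([], [])}"
      by (auto simp: 0 tableau_pairs_eq tableaux_0)
    ultimately show ?thesis by (simp add: 0 immacutation_tails_def bij_betw_def)
  next
    case (Suc m)
    let ?S = shifted_right_of_one
    have IH: "bij_betw truncation_map (tableau_pairs (m - k)) (immacutation_tails (m - k))" for k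
      by (rule less.IH) (simp add: Suc)
    \<comment> \<open>For two tableaux, having a common shape means having equal sizes of the split-off sets
      and, after truncation, again a common shape.\<close>
    have pairs: "(T\<^sub>1, T\<^sub>2) \<in> tableau_pairs (Suc m) \<longleftrightarrow>
        card (?S T\<^sub>1) = card (?S T\<^sub>2) \<and>
        (truncate T\<^sub>1, truncate T\<^sub>2) \<in> tableau_pairs (m - card (?S T\<^sub>1))"
      if "T\<^sub>1 \<in> tableaux (Suc m)" "T\<^sub>2 \<in> tableaux (Suc m)" for T\<^sub>1 T\<^sub>2
      using that split_first_row_in(2,4)[OF that(1)] split_first_row_in(2,4)[OF that(2)]
      by (auto simp: tableau_pairs_eq)
    have mem: "T\<^sub>1 \<in> tableaux (Suc m)" "T\<^sub>2 \<in> tableaux (Suc m)"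
      if "(T\<^sub>1, T\<^sub>2) \<in> tableau_pairs (Suc m)" for T\<^sub>1 T\<^sub>2
      using that by (auto simp: tableau_pairs_eq)
    have "inj_on truncation_map (tableau_pairs (Suc m))"
    proof (rule inj_onI, clarify)
      fix T\<^sub>1 T\<^sub>2 U\<^sub>1 U\<^sub>2
      assume T: "(T\<^sub>1, T\<^sub>2) \<in> tableau_pairs (Suc m)" and U: "(U\<^sub>1, U\<^sub>2) \<in> tableau_pairs (Suc m)"
        and "truncation_map (T\<^sub>1, T\<^sub>2) = truncation_map (U\<^sub>1, U\<^sub>2)"
      then have S: "?S T\<^sub>1 = ?S U\<^sub>1" "?S T\<^sub>2 = ?S U\<^sub>2"
        and tr: "truncation_map (truncate T\<^sub>1, truncate T\<^sub>2) = truncation_map (truncate U\<^sub>1, truncate U\<^sub>2)"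
        using truncation_map_Suc[OF mem(1)[OF T]] truncation_map_Suc[OF mem(1)[OF U]] by simp_all
      have "(truncate T\<^sub>1, truncate T\<^sub>2) = (truncate U\<^sub>1, truncate U\<^sub>2)"
        using pairs[OF mem[OF T]] pairs[OF mem[OF U]] T U S
        by (intro inj_onD[OF bij_betw_imp_inj_on[OF IH[of "card (?S T\<^sub>1)"]] tr]) auto
      then show "T\<^sub>1 = U\<^sub>1 \<and> T\<^sub>2 = U\<^sub>2"
        using inj_onD[OF bij_betw_imp_inj_on[OF bij_betw_split_first_row[of m]]]
          mem[OF T] mem[OF U] S by simp
    qed
    moreover have "truncation_map ` tableau_pairs (Suc m) = immacutation_tails (Suc m)"
    proof (intro equalityI subsetI)
      fix t assume "t \<in> truncation_map ` tableau_pairs (Suc m)"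
      then obtain T\<^sub>1 T\<^sub>2 where T: "(T\<^sub>1, T\<^sub>2) \<in> tableau_pairs (Suc m)" and t: "t = truncation_map (T\<^sub>1, T\<^sub>2)"
        by auto
      then have "truncation_map (truncate T\<^sub>1, truncate T\<^sub>2) \<in> immacutation_tails (m - card (?S T\<^sub>1))"
        using bij_betwE[OF IH] pairs[OF mem[OF T]] by blast
      then show "t \<in> immacutation_tails (Suc m)"
        using T mem[OF T] pairs[OF mem[OF T]] split_first_row_in(1)
        unfolding t immacutation_tails_Suc truncation_map_Suc[OF mem(1)[OF T]] by blast
    next
      fix u assume "u \<in> immacutation_tails (Suc m)"
      then obtain A B t where u: "u = A # B # t" and AB: "A \<subseteq> {1..m}" "B \<subseteq> {1..m}" "card A = card B"
        and "t \<in> immacutation_tails (m - card A)"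
        unfolding immacutation_tails_Suc by blast
      then obtain T\<^sub>1 T\<^sub>2 where T: "(T\<^sub>1, T\<^sub>2) \<in> tableau_pairs (m - card A)"
        and t: "t = truncation_map (T\<^sub>1, T\<^sub>2)"
        using bij_betw_imp_surj_on[OF IH] by (metis imageE surj_pair)
      then have T': "T\<^sub>1 \<in> tableaux (m - card A)" "T\<^sub>2 \<in> tableaux (m - card B)"
        using AB(3) by (auto simp: tableau_pairs_eq)
      note P = prepend_row_in[OF AB(1) T'(1)] and Q = prepend_row_in[OF AB(2) T'(2)]
      have "(prepend_row m A T\<^sub>1, prepend_row m B T\<^sub>2) \<in> tableau_pairs (Suc m)"
        using pairs[OF P(1) Q(1)] P Q AB(3) T by simp
      moreover have "truncation_map (prepend_row m A T\<^sub>1, prepend_row m B T\<^sub>2) = u"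
        using P Q by (simp add: truncation_map_Suc u t)
      ultimately show "u \<in> truncation_map ` tableau_pairs (Suc m)" by (metis imageI)
    qed
    ultimately show ?thesis by (simp add: bij_betw_def Suc)
  qed
qed

theorem theorem3:
  fixes n :: nat
  assumes "0 < n"
  shows "bij_betw truncation_map (tableau_pairs n) (immacutations n)"
  using bij_betw_truncation_map_tails[of n] assms by (simp add: immacutation_tails_def)

end
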